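(* Let $A\subset\mathbb Z^{d+1}$ be a homogeneous, non-pyramidal configuration of affine dimension $d$, of the form $A=\{(1,a'):a'\in A'\}$ with $A'\subset\mathbb Z^d$ a finite configuration whose differences generate $\mathbb Z^d$ as a group, and let $B$ be a Gale dual of $A$. 1. If $\theta(A)=m(A)-2$, then $B^{\rm red}$ is a non-defective configuration of rank $2$. 2. If $\theta(A)=m(A)-3$, then either $B^{\rm red}$ is a non-defective configuration of rank $3$, or it is a rank $4$ configuration with defect equal to $1$.
   Context: Configurations are finite indexed families of not necessarily distinct vectors; $A=\{a_1,\dots,a_n\}$ is identified with the matrix with columns $a_i$. $m(A)=n-d(A)-1$ with $d(A)$ the dimension of the affine span. $A$ is homogeneous if $(1,\dots,1)$ lies in the rational row span of the matrix; it is a pyramid if some affine hyperplane contains all points of $A$ except one (equivalently, some $a_i$ is not in the affine span of the others), and non-pyramidal otherwise. Gale dual: $B=\{b_1,\dots,b_n\}\subset\mathbb Q^{m(A)}$, the rows of a matrix whose columns are a basis of $\ker_{\mathbb Q}(A)$. $L(\cdot)$ is $\mathbb Q$-linear span, the rank of a configuration $C$ of vectors is $\dim L(C)$, $\mathfrak s(C)=\sum_{b\in C}b$, and $C$ is dual-homogeneous if $\mathfrak s(C)=0$. For a dual-homogeneous configuration $C$ (such as $B$ or $B^{\rm red}$), a Cayley decomposition of length $r\ge0$ is a partition $C=C_0\cup\dots\cup C_r$ into nonempty dual-homogeneous subconfigurations; $c(C_0,\dots,C_r)=\sum_j\dim L(C_j)-\dim L(C)$; $\theta(C)$, called the defect of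 $C$, is the maximum of $r-c(C_0,\dots,C_r)$ over all Cayley decompositions of $C$. $C$ is defective if $\theta(C)>0$ and non-defective if $\theta(C)=0$. Put $\theta(A)=\theta(B)$. Reduction: a rank-one flat of $B$ is a subfamily $F=\{b\in B: b\in\Lambda\}$ spanning a line $\Lambda$; it is splitting if $\mathfrak s(F)=0$ and non-splitting otherwise. $B^{\rm red}$ is the (dual-homogeneous) configuration consisting of one vector $\mathfrak s(F)$ for each non-splitting rank-one flat $F$ of $B$ (elements in splitting rank-one flats are discarded). *)

theory Defs
  imports
    "HOL-Analysis.Analysis"
    "HOL-Computational_Algebra.Group_Closure"
    "HOL-Library.Disjoint_Sets"
begin

text \<open>
  A configuration is a family, so repeated vectors are allowed. Integer configurations are
  functions on a finite index type. Configurations of rational vectors come with an explicit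
  index set, so that a subconfiguration is a subset of indices. The locale \<open>vec\<close> of
  HOL-Analysis supplies linear algebra over the rationals.
\<close>

section \<open>Integer point configurations\<close>

definition config_matrix :: "('n::finite \<Rightarrow> int ^ 'k::finite) \<Rightarrow> rat ^ 'n ^ 'k" where
  "config_matrix A = (\<chi> k i. of_int (A i $ k))"

definition real_point :: "int ^ 'k::finite \<Rightarrow> real ^ 'k" where
  "real_point v = (\<chi> k. of_int (v $ k))"

text \<open>
  Affine notions are taken over the reals, where the library provides them. For integer points
  the dimension of the affine span and membership of an integer point in it are the same over
  the rationals.
\<close>

definition affine_dimension :: "('n::finite \<Rightarrow> int ^ 'k::finite) \<Rightarrow> int" where
  "affine_dimension A = aff_dim (range (\<lambda>i. real_point (A i)))"

definition codimension :: "('n::finite \<Rightarrow> int ^ 'k::finite) \<Rightarrow> int" where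
  "codimension A = int CARD('n) - affine_dimension A - 1"

definition homogeneous :: "('n::finite \<Rightarrow> int ^ 'k::finite) \<Rightarrow> bool" where
  "homogeneous A \<longleftrightarrow> (\<chi> i. 1) \<in> vec.span (rows (config_matrix A))"

definition pyramid :: "('n::finite \<Rightarrow> int ^ 'k::finite) \<Rightarrow> bool" where
  "pyramid A \<longleftrightarrow>
     (\<exists>i. real_point (A i) \<notin> affine hull ((\<lambda>j. real_point (A j)) ` (UNIV - {i})))"

text \<open>
  The sublattice of vectors vanishing in coordinate \<open>k0\<close>. If the ambient space has \<open>d + 1\<close>
  coordinates this is a copy of the lattice of rank \<open>d\<close>; unlike a type of vectors with a
  \<open>d\<close>-element index type, it also covers \<open>d = 0\<close>.
\<close>

definition coord_lattice :: "'k::finite \<Rightarrow> (int ^ 'k) set" where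
  "coord_lattice k0 = {v. v $ k0 = 0}"

text \<open>For \<open>v\<close> in \<open>coord_lattice k0\<close>, this is the vector \<open>(1, v)\<close>, with the 1 in position \<open>k0\<close>.\<close>

definition cone_point :: "'k::finite \<Rightarrow> int ^ 'k \<Rightarrow> int ^ 'k" where
  "cone_point k0 v = (\<chi> k. if k = k0 then 1 else v $ k)"


section \<open>Gale duals\<close>

text \<open>
  The vectors \<open>B i\<close> are the rows of a matrix whose columns, as a family, form a basis of the
  kernel; injectivity is needed because \<open>columns\<close> is a set.
\<close>

definition gale_dual :: "('n::finite \<Rightarrow> int ^ 'k::finite) \<Rightarrow> ('n \<Rightarrow> rat ^ 'm::finite) \<Rightarrow> bool" where
  "gale_dual A B \<longleftrightarrow>
     (let M = (\<chi> i. B i) :: rat ^ 'm ^ 'n in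
       int CARD('m) = codimension A \<and>
       inj (\<lambda>j. column j M) \<and>
       vec.independent (columns M) \<and>
       vec.span (columns M) = {x. config_matrix A *v x = 0})"


section \<open>Cayley decompositions and the defect\<close>

definition config_rank :: "'i set \<Rightarrow> ('i \<Rightarrow> rat ^ 'm::finite) \<Rightarrow> nat" where
  "config_rank I C = vec.dim (vec.span (C ` I))"

definition dual_homogeneous :: "'i set \<Rightarrow> ('i \<Rightarrow> rat ^ 'm::finite) \<Rightarrow> bool" where
  "dual_homogeneous I C \<longleftrightarrow> (\<Sum>i\<in>I. C i) = 0"

text \<open>A Cayley decomposition of length \<open>r\<close> has \<open>r + 1\<close> parts.\<close>

definition cayley_decomposition ::
    "'i set \<Rightarrow> ('i \<Rightarrow> rat ^ 'm::finite) \<Rightarrow> nat \<Rightarrow> 'i set set \<Rightarrow> bool" where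
  "cayley_decomposition I C r P \<longleftrightarrow>
     partition_on I P \<and> card P = Suc r \<and> (\<forall>J\<in>P. dual_homogeneous J C)"

definition cayley_excess :: "'i set \<Rightarrow> ('i \<Rightarrow> rat ^ 'm::finite) \<Rightarrow> 'i set set \<Rightarrow> int" where
  "cayley_excess I C P = (\<Sum>J\<in>P. int (config_rank J C)) - int (config_rank I C)"

text \<open>
  Meaningful for finite, nonempty, dual-homogeneous configurations. The empty configuration has
  no Cayley decomposition, so its defect is left unspecified.
\<close>

definition defect :: "'i set \<Rightarrow> ('i \<Rightarrow> rat ^ 'm::finite) \<Rightarrow> int" where
  "defect I C = Max {int r - cayley_excess I C P | r P. cayley_decomposition I C r P}"

definition non_defective :: "'i set \<Rightarrow> ('i \<Rightarrow> rat ^ 'm::finite) \<Rightarrow> bool" where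
  "non_defective I C \<longleftrightarrow> defect I C = 0"


section \<open>Reduction\<close>

definition rank_one_flat :: "'i set \<Rightarrow> ('i \<Rightarrow> rat ^ 'm::finite) \<Rightarrow> 'i set \<Rightarrow> bool" where
  "rank_one_flat I C F \<longleftrightarrow>
     (\<exists>L. vec.subspace L \<and> vec.dim L = 1 \<and> F = {i\<in>I. C i \<in> L} \<and> vec.span (C ` F) = L)"

definition splitting :: "('i \<Rightarrow> rat ^ 'm::finite) \<Rightarrow> 'i set \<Rightarrow> bool" where
  "splitting C F \<longleftrightarrow> (\<Sum>i\<in>F. C i) = 0"

text \<open>
  The reduced configuration is the family \<open>red_vector C\<close> indexed by \<open>red_index I C\<close>; its
  indices are the non-splitting rank-one flats themselves.
\<close>

definition red_index :: "'i set \<Rightarrow> ('i \<Rightarrow> rat ^ 'm::finite) \<Rightarrow> 'i set set" where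
  "red_index I C = {F. rank_one_flat I C F \<and> \<not> splitting C F}"

definition red_vector :: "('i \<Rightarrow> rat ^ 'm::finite) \<Rightarrow> 'i set \<Rightarrow> rat ^ 'm" where
  "red_vector C F = (\<Sum>i\<in>F. C i)"

end

theory Submission
  imports Defs
begin

text \<open>
  Since a partition into \<open>r + 1\<close> parts has value
  \<open>rank C - 1 - (\<Sum>J. rank J - 1)\<close>, a small difference between \<open>rank C - 1\<close> and the defect
  means that an optimal Cayley decomposition consists of parts of rank 1 up to a few exceptions:
  if \<open>\<theta>(C) = rank C - 1 - k\<close> and no vector of \<open>C\<close> is zero, then at most \<open>k\<close> parts have rank
  at least 2, and the ranks of these large parts add up to at most \<open>2 k\<close>.

  A part of rank 1 lies in a single rank-one flat and sums to zero, so it contributes nothing to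
  the sum of a flat. Hence every reduced vector lies in the span of the large parts, and the
  reduced configuration has rank \<open>\<rho> \<le> 2 k\<close> (\<open>rank_red_le\<close>). Conversely, the splitting flats
  together with the union of all non-splitting flats form a Cayley decomposition, which gives
  \<open>\<rho> \<ge> k + 1\<close> (\<open>defect_ge_rank_minus_rank_red\<close>). For \<open>k = 1\<close> this leaves only \<open>\<rho> = 2\<close>, and for
  \<open>k = 2\<close> only \<open>\<rho> = 3\<close> and \<open>\<rho> = 4\<close>.

  The defect of the reduced configuration is bounded from above because its vectors are nonzero
  and pairwise non-parallel, so that every part of a Cayley decomposition has rank at least 2
  (\<open>defect_le_rank_minus_3\<close>). This gives defect 0 for \<open>\<rho> \<le> 3\<close> and defect at most 1 for
  \<open>\<rho> = 4\<close>. In the latter case there are two large parts of rank 2 with independent spans, and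
  distributing the reduced vectors over these two planes is a Cayley decomposition of value 1
  (\<open>defect_red_ge_1\<close>).

  It remains to check that a Gale dual has rank \<open>m(A)\<close>, is dual-homogeneous because \<open>A\<close> is
  homogeneous, and has no zero vector because \<open>A\<close> is not a pyramid.
\<close>

section \<open>The defect as a maximum\<close>

lemma config_rank_eq_dim: "config_rank I C = vec.dim (C ` I)"
  by (simp add: config_rank_def)

text \<open>
  The length \<open>r\<close> is one less than the number of parts. Written as a sum over the parts, the
  quantity maximised by the defect shows that parts of rank 1 are free of cost.
\<close>

lemma cayley_value:
  assumes "cayley_decomposition I C r P"
  shows "int r - cayley_excess I C P
           = int (config_rank I C) - 1 - (\<Sum>J\<in>P. int (config_rank J C) - 1)"
proof -
  have "card P = Suc r"
    using assms by (auto simp: cayley_decomposition_def)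
  then show ?thesis
    by (simp add: cayley_excess_def sum_subtractf)
qed

lemma finite_cayley_values:
  assumes "finite I"
  shows "finite {int r - cayley_excess I C P | r P. cayley_decomposition I C r P}"
proof (rule finite_subset)
  show "{int r - cayley_excess I C P | r P. cayley_decomposition I C r P}
          \<subseteq> (\<lambda>P. int (card P - 1) - cayley_excess I C P) ` {P. partition_on I P}"
    by (force simp: cayley_decomposition_def)
qed (simp add: assms finitely_many_partition_on)

lemma defect_ge:
  assumes "finite I" "cayley_decomposition I C r P"
  shows "int (config_rank I C) - 1 - (\<Sum>J\<in>P. int (config_rank J C) - 1) \<le> defect I C"
  unfolding defect_def cayley_value[OF assms(2), symmetric]
  using assms finite_cayley_values by (intro Max_ge) auto

lemma cayley_decomposition_trivial:
  assumes "I \<noteq> {}" "dual_homogeneous I C"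
  shows "cayley_decomposition I C 0 {I}"
  using assms by (simp add: cayley_decomposition_def partition_on_space)

lemma defect_attained:
  assumes "finite I" "I \<noteq> {}" "dual_homogeneous I C"
  obtains r P where "cayley_decomposition I C r P"
    and "defect I C = int (config_rank I C) - 1 - (\<Sum>J\<in>P. int (config_rank J C) - 1)"
proof -
  have "defect I C \<in> {int r - cayley_excess I C P | r P. cayley_decomposition I C r P}"
    unfolding defect_def
    using assms finite_cayley_values cayley_decomposition_trivial by (intro Max_in) blast+
  then show thesis
    using that cayley_value by force
qed

lemma defect_nonneg:
  assumes "finite I" "I \<noteq> {}" "dual_homogeneous I C"
  shows "0 \<le> defect I C"
  using defect_ge[OF assms(1) cayley_decomposition_trivial[OF assms(2,3)]] by simp

section \<open>Rank-one flats\<close>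

lemma span_singleton_eq:
  fixes v w :: "rat ^ 'm::finite"
  assumes "v \<noteq> 0" "v \<in> vec.span {w}"
  shows "vec.span {v} = vec.span {w}"
proof (rule vec.subspace_dim_equal)
  show "vec.span {v} \<subseteq> vec.span {w}"
    using assms by (intro vec.span_minimal) auto
  show "vec.dim (vec.span {w}) \<le> vec.dim (vec.span {v})"
    using assms by (simp del: One_nat_def)
qed auto

lemma config_rank_ge_1:
  assumes "J \<noteq> {}" "\<And>i. i \<in> J \<Longrightarrow> C i \<noteq> 0"
  shows "1 \<le> config_rank J C"
proof -
  have "vec.dim (C ` J) \<noteq> 0"
    using assms vec.dim_eq_0[of "C ` J"] by blast
  then show ?thesis
    unfolding config_rank_eq_dim by linarith
qed

text \<open>
  The line in the definition of a rank-one flat is determined by the flat as its span; the next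
  two facts replace the existential quantifier by this span.
\<close>

lemma rank_one_flat_eq:
  assumes "rank_one_flat I C F"
  shows "F = {i \<in> I. C i \<in> vec.span (C ` F)}"
  using assms unfolding rank_one_flat_def by blast

lemma rank_one_flat_span:
  assumes "rank_one_flat I C F" "w \<in> vec.span (C ` F)" "w \<noteq> 0"
  shows "vec.span (C ` F) = vec.span {w}"
proof (rule sym, rule vec.subspace_dim_equal)
  have "vec.dim (vec.span (C ` F)) = 1"
    using assms(1) unfolding rank_one_flat_def by metis
  then show "vec.dim (vec.span (C ` F)) \<le> vec.dim (vec.span {w})"
    using assms(3) by simp
  show "vec.span {w} \<subseteq> vec.span (C ` F)"
    using assms(2) by (intro vec.span_minimal) auto
qed auto

lemma rank_one_flat_through:
  assumes "i \<in> I" "C i \<noteq> 0"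
  shows "rank_one_flat I C {j \<in> I. C j \<in> vec.span {C i}}" (is "rank_one_flat I C ?F")
  unfolding rank_one_flat_def
proof (intro exI conjI)
  show "vec.span (C ` ?F) = vec.span {C i}"
  proof (rule antisym)
    show "vec.span (C ` ?F) \<subseteq> vec.span {C i}"
      by (rule vec.span_minimal) auto
    show "vec.span {C i} \<subseteq> vec.span (C ` ?F)"
      using assms by (intro vec.span_mono) (auto intro: vec.span_base)
  qed
qed (use assms in auto)

lemma rank_one_flats_partition:
  assumes "\<And>i. i \<in> I \<Longrightarrow> C i \<noteq> 0"
  shows "partition_on I {F. rank_one_flat I C F}"
proof (rule partition_onI)
  show "\<Union>{F. rank_one_flat I C F} = I"
  proof
    show "\<Union>{F. rank_one_flat I C F} \<subseteq> I"
      using rank_one_flat_eq by fastforce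
    show "I \<subseteq> \<Union>{F. rank_one_flat I C F}"
      using rank_one_flat_through[of _ I C] assms by (fastforce intro: vec.span_base)
  qed
next
  fix F G assume F: "F \<in> {F. rank_one_flat I C F}" and G: "G \<in> {F. rank_one_flat I C F}"
    and "F \<noteq> G"
  show "disjnt F G"
  proof (rule ccontr)
    assume "\<not> disjnt F G"
    then obtain i where i: "i \<in> F" "i \<in> G"
      by (auto simp: disjnt_def)
    then have "i \<in> I"
      using rank_one_flat_eq[of I C F] F by blast
    then have "vec.span (C ` H) = vec.span {C i}" if "H \<in> {F, G}" for H
      using that i F G assms by (intro rank_one_flat_span) (auto intro: vec.span_base)
    then have "vec.span (C ` F) = vec.span (C ` G)"
      by simp
    then show False
      using rank_one_flat_eq[of I C F] rank_one_flat_eq[of I C G] F G \<open>F \<noteq> G\<close> by auto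
  qed
next
  show "{} \<notin> {F. rank_one_flat I C F}"
    by (auto simp: rank_one_flat_def)
qed

section \<open>The reduced configuration\<close>

lemma finite_red_index:
  assumes "finite I"
  shows "finite (red_index I C)"
proof (rule finite_subset)
  show "red_index I C \<subseteq> Pow I"
    using rank_one_flat_eq by (fastforce simp: red_index_def)
qed (simp add: assms)

lemma red_vector_nonzero: "F \<in> red_index I C \<Longrightarrow> red_vector C F \<noteq> 0"
  by (simp add: red_index_def red_vector_def splitting_def)

lemma span_red_vector:
  assumes "F \<in> red_index I C"
  shows "vec.span {red_vector C F} = vec.span (C ` F)"
proof -
  have "red_vector C F \<in> vec.span (C ` F)"
    unfolding red_vector_def by (intro vec.span_sum vec.span_base) auto
  then show ?thesis
    using assms rank_one_flat_span[of I C F "red_vector C F"] red_vector_nonzero[OF assms]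
    by (auto simp: red_index_def)
qed

text \<open>
  The vector of a non-splitting flat spans the line of the flat, and a flat is recovered from its
  line.
\<close>

lemma red_vectors_not_parallel:
  assumes "F \<in> red_index I C" "G \<in> red_index I C" "F \<noteq> G"
  shows "red_vector C F \<notin> vec.span {red_vector C G}"
proof
  assume "red_vector C F \<in> vec.span {red_vector C G}"
  then have "vec.span (C ` F) = vec.span (C ` G)"
    using span_singleton_eq assms red_vector_nonzero span_red_vector by metis
  then show False
    using rank_one_flat_eq[of I C F] rank_one_flat_eq[of I C G] assms
    by (auto simp: red_index_def)
qed

text \<open>
  The rank-one flats partition the index set, and the splitting ones contribute zero to the total
  sum.
\<close>

lemma dual_homogeneous_red:
  assumes "finite I" "\<And>i. i \<in> I \<Longrightarrow> C i \<noteq> 0" "dual_homogeneous I C"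
  shows "dual_homogeneous (red_index I C) (red_vector C)"
proof -
  have part: "partition_on I {F. rank_one_flat I C F}"
    using assms(2) by (rule rank_one_flats_partition)
  then have "finite {F. rank_one_flat I C F}"
    using assms(1) finite_elements by blast
  then have "sum (red_vector C) (red_index I C) = sum (red_vector C) {F. rank_one_flat I C F}"
    by (intro sum.mono_neutral_left) (auto simp: red_index_def red_vector_def splitting_def)
  also have "\<dots> = sum C I"
    unfolding red_vector_def using sum.partition[OF assms(1) part, of C] by simp
  finally show ?thesis
    using assms(3) by (simp add: dual_homogeneous_def)
qed

section \<open>Configurations without parallel vectors\<close>

lemma config_rank_ge_2:
  assumes nz: "\<And>i. i \<in> J \<Longrightarrow> C i \<noteq> 0"
    and par: "\<And>i j. i \<in> J \<Longrightarrow> j \<in> J \<Longrightarrow> i \<noteq> j \<Longrightarrow> C i \<notin> vec.span {C j}"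
    and J: "J \<noteq> {}" "dual_homogeneous J C"
  shows "2 \<le> config_rank J C"
proof -
  obtain j where j: "j \<in> J"
    using J by auto
  \<comment> \<open>A single nonzero vector does not sum to zero.\<close>
  have "J \<noteq> {j}"
    using nz[OF j] J by (auto simp: dual_homogeneous_def)
  then obtain i where i: "i \<in> J" "i \<noteq> j"
    using j by auto
  have "vec.independent {C j}"
    using nz[OF j] by (simp add: vec.dependent_single)
  then have "vec.independent {C i, C j}"
    using par[OF i(1) j i(2)] by (simp add: vec.independent_insertI)
  moreover have "C i \<noteq> C j"
    using par[OF i(1) j i(2)] vec.span_base[of "C j" "{C j}"] by auto
  ultimately have "vec.dim {C i, C j} = 2"
    using vec.dim_eq_card_independent[of "{C i, C j}"] by simp
  moreover have "vec.dim {C i, C j} \<le> vec.dim (C ` J)"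
    using i j by (intro vec.dim_subset) auto
  ultimately show ?thesis
    by (simp add: config_rank_eq_dim)
qed

text \<open>
  Each part has rank at least 2 by \<open>config_rank_ge_2\<close>, so a decomposition of length \<open>r\<close>
  has value at most \<open>rank - 2 - r\<close>. This is at most \<open>rank - 3\<close> unless \<open>r = 0\<close>, where the trivial
  decomposition has value exactly 0.
\<close>

lemma defect_le_rank_minus_3:
  assumes fin: "finite I" and I: "I \<noteq> {}" "dual_homogeneous I C"
    and nz: "\<And>i. i \<in> I \<Longrightarrow> C i \<noteq> 0"
    and par: "\<And>i j. i \<in> I \<Longrightarrow> j \<in> I \<Longrightarrow> i \<noteq> j \<Longrightarrow> C i \<notin> vec.span {C j}"
  shows "defect I C \<le> max 0 (int (config_rank I C) - 3)"
proof -
  obtain r P where P: "cayley_decomposition I C r P"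
    and def: "defect I C = int (config_rank I C) - 1 - (\<Sum>J\<in>P. int (config_rank J C) - 1)"
    using defect_attained[OF fin I] by blast
  have part: "partition_on I P" and card: "card P = Suc r"
    using P by (auto simp: cayley_decomposition_def)
  have ge: "1 \<le> int (config_rank J C) - 1" if "J \<in> P" for J
  proof -
    have sub: "J \<subseteq> I" and "J \<noteq> {}" "dual_homogeneous J C"
      using part P that by (auto simp: partition_on_def cayley_decomposition_def)
    have "2 \<le> config_rank J C"
    proof (rule config_rank_ge_2)
      show "C i \<noteq> 0" if "i \<in> J" for i
        using that sub nz by auto
      show "C i \<notin> vec.span {C j}" if "i \<in> J" "j \<in> J" "i \<noteq> j" for i j
        using that sub par by auto
    qed fact+
    then show ?thesis by simp
  qed
  show ?thesis
  proof (cases "r = 0")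
    case True
    then obtain J where "P = {J}"
      using card by (auto simp: card_1_singleton_iff)
    moreover have "J = I"
      using part calculation by (auto simp: partition_on_def)
    ultimately show ?thesis
      using def by simp
  next
    case False
    have "int (card P) \<le> (\<Sum>J\<in>P. int (config_rank J C) - 1)"
      using sum_mono[of P "\<lambda>_. 1" "\<lambda>J. int (config_rank J C) - 1"] ge by simp
    then show ?thesis
      using def card False by simp
  qed
qed

section \<open>Comparing a configuration with its reduction\<close>

text \<open>
  The witness is the Cayley decomposition into the splitting flats and the union \<open>N\<close> of the
  non-splitting ones. The splitting flats have rank 1, and \<open>N\<close> spans the same space as the
  reduced vectors. If every flat is splitting then \<open>N\<close> is empty and has to be left out; this
  accounts for the maximum with 1.
\<close>

lemma defect_ge_rank_minus_rank_red:
  assumes fin: "finite I" and I: "I \<noteq> {}" "dual_homogeneous I C"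
    and nz: "\<And>i. i \<in> I \<Longrightarrow> C i \<noteq> 0"
  shows "int (config_rank I C) - max 1 (int (config_rank (red_index I C) (red_vector C)))
           \<le> defect I C"
proof -
  define \<F> where "\<F> = {F. rank_one_flat I C F}"
  define S where "S = {F \<in> \<F>. splitting C F}"
  define R where "R = red_index I C"
  have part: "partition_on I \<F>"
    unfolding \<F>_def using nz by (rule rank_one_flats_partition)
  have fin\<F>: "finite \<F>"
    using fin part finite_elements by blast
  have split: "\<F> = S \<union> R" "S \<inter> R = {}"
    by (auto simp: \<F>_def S_def R_def red_index_def)
  have S0: "(\<Sum>F\<in>S. int (config_rank F C) - 1) = 0"
  proof (rule sum.neutral, rule ballI)
    fix F assume "F \<in> S"
    then have "rank_one_flat I C F"
      by (simp add: S_def \<F>_def)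
    then have "config_rank F C = 1"
      unfolding rank_one_flat_def config_rank_def by metis
    then show "int (config_rank F C) - 1 = 0"
      by simp
  qed
  have Shom: "dual_homogeneous F C" if "F \<in> S" for F
    using that by (simp add: S_def splitting_def dual_homogeneous_def)
  show ?thesis
  proof (cases "R = {}")
    case True
    then have S: "S = \<F>"
      using split by simp
    have "\<F> \<noteq> {}"
      using I(1) partition_onD1[OF part] by blast
    then have "card S = Suc (card S - 1)"
      using fin\<F> card_gt_0_iff[of S] S by simp
    then have "cayley_decomposition I C (card S - 1) S"
      unfolding cayley_decomposition_def using part Shom S by blast
    from defect_ge[OF fin this] S0 show ?thesis
      by simp
  next
    case False
    define N where "N = \<Union>R"
    have sub: "partition_on (\<Union>X) X" if "X \<subseteq> \<F>" for X
      using part that pairwise_subset[of disjnt \<F> X] by (auto simp: partition_on_def)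
    have partS: "partition_on (\<Union>S) S" and partR: "partition_on N R"
      using sub[of S] sub[of R] split(1) by (simp_all add: N_def)
    have N: "N \<noteq> {}"
      using partR False by (metis partition_on_empty)
    have disj: "disjnt N (\<Union>S)"
    proof -
      have "F \<inter> G = {}" if FG: "F \<in> R" "G \<in> S" for F G
      proof (rule disjointD[OF partition_onD2[OF part]])
        show "F \<in> \<F>" "G \<in> \<F>"
          using FG split(1) by simp_all
        show "F \<noteq> G"
          using FG split(2) by (metis IntI empty_iff)
      qed
      then show ?thesis
        by (auto simp: N_def disjnt_def)
    qed
    have notin: "N \<notin> S"
      using disj N by (auto simp: disjnt_def)
    have IN: "I = N \<union> \<Union>S"
      using partition_onD1[OF part] split(1) by (auto simp: N_def)
    have "I - N = \<Union>S"
      using IN disj by (auto simp: disjnt_def)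
    then have partNS: "partition_on I (insert N S)"
      using partition_on_insert[OF disj, of I] partS N IN by simp
    have "sum C N = 0"
    proof -
      have "finite N"
        using fin IN by simp
      then have "sum C N = sum (red_vector C) R"
        unfolding red_vector_def using partR by (rule sum.partition)
      then show ?thesis
        using dual_homogeneous_red[OF fin nz I(2)] by (simp add: R_def dual_homogeneous_def)
    qed
    then have "cayley_decomposition I C (card S) (insert N S)"
      using partNS notin Shom fin\<F> split
      by (auto simp: cayley_decomposition_def dual_homogeneous_def)
    from defect_ge[OF fin this]
    have "int (config_rank I C) - 1 - (int (config_rank N C) - 1) \<le> defect I C"
      using S0 notin fin\<F> split by simp
    moreover have "config_rank N C \<le> config_rank R (red_vector C)"
      unfolding config_rank_eq_dim
    proof (rule vec.dim_mono, rule image_subsetI)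
      fix i assume "i \<in> N"
      then obtain F where F: "F \<in> R" "i \<in> F"
        by (auto simp: N_def)
      then have "C i \<in> vec.span {red_vector C F}"
        using span_red_vector[of F I C] by (auto simp: R_def intro: vec.span_base)
      also have "\<dots> \<subseteq> vec.span (red_vector C ` R)"
        using F by (intro vec.span_mono) auto
      finally show "C i \<in> vec.span (red_vector C ` R)" .
    qed
    ultimately show ?thesis
      by (simp add: R_def)
  qed
qed

text \<open>
  A part \<open>J\<close> of rank at most 1 that meets the flat \<open>F\<close> is contained in \<open>F\<close>, because both span the
  same line. Being dual-homogeneous, it then cancels from the sum over \<open>F\<close>.
\<close>

lemma red_vector_eq_sum_of_large_parts:
  assumes fin: "finite I" and nz: "\<And>i. i \<in> I \<Longrightarrow> C i \<noteq> 0"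
    and P: "cayley_decomposition I C r P" and F: "rank_one_flat I C F"
  shows "red_vector C F = (\<Sum>J | J \<in> P \<and> 2 \<le> config_rank J C. \<Sum>i\<in>F \<inter> J. C i)"
proof -
  have part: "partition_on I P" and hom: "\<And>J. J \<in> P \<Longrightarrow> dual_homogeneous J C"
    using P by (auto simp: cayley_decomposition_def)
  have finP: "finite P"
    using fin part finite_elements by blast
  have FI: "F \<subseteq> I"
    using rank_one_flat_eq[OF F] by blast
  have small: "(\<Sum>i\<in>F \<inter> J. C i) = 0" if J: "J \<in> P" "\<not> 2 \<le> config_rank J C" for J
  proof (cases "F \<inter> J = {}")
    case False
    then obtain i where i: "i \<in> F" "i \<in> J"
      by blast
    have JI: "J \<subseteq> I"
      using J part by (auto simp: partition_on_def)
    have "C i \<noteq> 0"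
      using i JI nz by auto
    have "vec.span {C i} = vec.span (C ` J)"
    proof (rule vec.subspace_dim_equal)
      show "vec.span {C i} \<subseteq> vec.span (C ` J)"
        using i by (intro vec.span_mono) auto
      show "vec.dim (vec.span (C ` J)) \<le> vec.dim (vec.span {C i})"
        using J \<open>C i \<noteq> 0\<close> by (simp add: config_rank_eq_dim)
    qed auto
    then have "vec.span (C ` J) = vec.span (C ` F)"
      using rank_one_flat_span[OF F, of "C i"] i \<open>C i \<noteq> 0\<close> by (auto intro: vec.span_base)
    then have "J \<subseteq> F"
      using rank_one_flat_eq[OF F] JI by (auto intro: vec.span_base)
    then show ?thesis
      using hom[OF J(1)] by (simp add: Int_absorb1 dual_homogeneous_def)
  qed simp
  have "red_vector C F = (\<Sum>i\<in>I. if i \<in> F then C i else 0)"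
    unfolding red_vector_def using sum.inter_restrict[OF fin, of C F] FI by (simp add: Int_absorb1)
  also have "\<dots> = (\<Sum>J\<in>P. \<Sum>i\<in>J. if i \<in> F then C i else 0)"
    by (rule sum.partition[OF fin part])
  also have "\<dots> = (\<Sum>J\<in>P. \<Sum>i\<in>F \<inter> J. C i)"
  proof (rule sum.cong[OF refl])
    fix J assume "J \<in> P"
    then have "finite J"
      using fin part by (auto simp: partition_on_def intro: finite_subset)
    then show "(\<Sum>i\<in>J. if i \<in> F then C i else 0) = (\<Sum>i\<in>F \<inter> J. C i)"
      using sum.inter_restrict[of J C F] by (simp add: Int_commute)
  qed
  also have "\<dots> = (\<Sum>J | J \<in> P \<and> 2 \<le> config_rank J C. \<Sum>i\<in>F \<inter> J. C i)"
    using finP small by (intro sum.mono_neutral_right) auto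
  finally show ?thesis .
qed

lemma dim_UN_le:
  fixes f :: "'j \<Rightarrow> (rat ^ 'm::finite) set"
  assumes "finite Q"
  shows "vec.dim (\<Union>J\<in>Q. f J) \<le> (\<Sum>J\<in>Q. vec.dim (f J))"
  using assms
proof induction
  case (insert J Q)
  have "vec.dim (f J \<union> (\<Union>K\<in>Q. f K)) = vec.dim (vec.span (f J \<union> (\<Union>K\<in>Q. f K)))"
    by simp
  also have "\<dots> \<le> vec.dim (f J) + vec.dim (\<Union>K\<in>Q. f K)"
    using vec.dim_sums_Int[of "vec.span (f J)" "vec.span (\<Union>K\<in>Q. f K)"]
    by (simp add: vec.span_Un del: vec.dim_span) (simp)
  finally show ?case
    using insert by simp
qed simp

lemma rank_red_le:
  assumes fin: "finite I" and nz: "\<And>i. i \<in> I \<Longrightarrow> C i \<noteq> 0"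
    and P: "cayley_decomposition I C r P"
  shows "config_rank (red_index I C) (red_vector C)
           \<le> (\<Sum>J | J \<in> P \<and> 2 \<le> config_rank J C. config_rank J C)"
proof -
  define Q where "Q = {J \<in> P. 2 \<le> config_rank J C}"
  have "finite P"
    using fin P finite_elements by (auto simp: cayley_decomposition_def)
  have "config_rank (red_index I C) (red_vector C) \<le> vec.dim (\<Union>J\<in>Q. C ` J)"
    unfolding config_rank_eq_dim
  proof (rule vec.dim_mono, rule image_subsetI)
    fix F assume "F \<in> red_index I C"
    then have "red_vector C F = (\<Sum>J\<in>Q. \<Sum>i\<in>F \<inter> J. C i)"
      unfolding Q_def using red_vector_eq_sum_of_large_parts[OF fin nz P]
      by (simp add: red_index_def)
    also have "\<dots> \<in> vec.span (\<Union>J\<in>Q. C ` J)"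
      by (intro vec.span_sum vec.span_base) blast
    finally show "red_vector C F \<in> vec.span (\<Union>J\<in>Q. C ` J)" .
  qed
  also have "\<dots> \<le> (\<Sum>J\<in>Q. vec.dim (C ` J))"
    using \<open>finite P\<close> by (intro dim_UN_le) (simp add: Q_def)
  finally show ?thesis
    by (simp add: Q_def config_rank_eq_dim)
qed

text \<open>
  If the rank of the reduction attains the bound of \<open>rank_red_le\<close>, the spans \<open>U\<close> and \<open>V\<close> of the
  two large parts meet only in zero. A flat must meet one of the large parts, as otherwise its sum
  would vanish, so its reduced vector lies in \<open>U\<close> or in \<open>V\<close>. The sums over these two groups of
  reduced vectors lie in \<open>U\<close> and \<open>V\<close> and add up to zero, so each of them is zero.
\<close>

lemma defect_red_ge_1:
  assumes fin: "finite I" and nz: "\<And>i. i \<in> I \<Longrightarrow> C i \<noteq> 0" and hom: "dual_homogeneous I C"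
    and P: "cayley_decomposition I C r P"
    and Q: "{J \<in> P. 2 \<le> config_rank J C} = {J, K}" "J \<noteq> K"
    and rank: "config_rank (red_index I C) (red_vector C) = config_rank J C + config_rank K C"
  shows "1 \<le> defect (red_index I C) (red_vector C)"
proof -
  define R where "R = red_index I C"
  define c where "c = red_vector C"
  define U where "U = vec.span (C ` J)"
  define V where "V = vec.span (C ` K)"
  define RU where "RU = {F \<in> R. c F \<in> U}"
  define RV where "RV = {F \<in> R. c F \<in> V}"
  have ge2: "2 \<le> vec.dim U" "2 \<le> vec.dim V"
    using Q by (auto simp: config_rank_eq_dim U_def V_def)
  have sub: "vec.subspace U" "vec.subspace V"
    by (auto simp: U_def V_def)
  have rankR: "config_rank R c = vec.dim U + vec.dim V"
    using rank by (simp add: R_def c_def U_def V_def config_rank_eq_dim)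
  have finR: "finite R"
    using fin finite_red_index by (simp add: R_def)
  have JK: "J \<subseteq> I" "K \<subseteq> I"
    using P Q by (auto simp: cayley_decomposition_def partition_on_def)
  have csum: "c F = (\<Sum>i\<in>F \<inter> J. C i) + (\<Sum>i\<in>F \<inter> K. C i)" if "F \<in> R" for F
    using red_vector_eq_sum_of_large_parts[OF fin nz P, of F] that Q
    by (simp add: c_def R_def red_index_def)
  have inU: "(\<Sum>i\<in>F \<inter> J. C i) \<in> U" and inV: "(\<Sum>i\<in>F \<inter> K. C i) \<in> V" for F
    unfolding U_def V_def by (intro vec.span_sum vec.span_base; auto)+
  have "config_rank R c \<le> vec.dim {x + y |x y. x \<in> U \<and> y \<in> V}"
    unfolding config_rank_eq_dim using csum inU inV by (intro vec.dim_subset) blast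
  then have "vec.dim (U \<inter> V) = 0"
    using vec.dim_sums_Int[OF sub] rankR by linarith
  then have UV: "U \<inter> V \<subseteq> {0}"
    by simp
  \<comment> \<open>The line of a flat meeting a part lies in the span of that part.\<close>
  have line: "c F \<in> vec.span (C ` L)" if F: "F \<in> R" and i: "i \<in> F" "i \<in> L" and "L \<subseteq> I" for F L i
  proof -
    have "vec.span {c F} = vec.span {C i}"
      using F i \<open>L \<subseteq> I\<close> nz span_red_vector[of F I C] rank_one_flat_span[of I C F "C i"]
      by (auto simp: R_def c_def red_index_def intro: vec.span_base)
    then have "c F \<in> vec.span {C i}"
      by (auto intro: vec.span_base)
    also have "\<dots> \<subseteq> vec.span (C ` L)"
      using i by (intro vec.span_mono) auto
    finally show ?thesis .
  qed
  have cov: "R = RU \<union> RV"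
  proof -
    have "c F \<in> U \<or> c F \<in> V" if F: "F \<in> R" for F
    proof (rule ccontr)
      assume "\<not> ?thesis"
      then have "F \<inter> J = {}" "F \<inter> K = {}"
        using line[OF F] JK by (auto simp: U_def V_def)
      then have "c F = 0"
        using csum[OF F] by simp
      then show False
        using red_vector_nonzero F by (auto simp: R_def c_def)
    qed
    then show ?thesis
      by (auto simp: RU_def RV_def)
  qed
  have disj: "RU \<inter> RV = {}"
    using UV red_vector_nonzero by (fastforce simp: RU_def RV_def R_def c_def)
  have fins: "finite RU" "finite RV"
    using finR by (auto simp: RU_def RV_def)
  have rU: "config_rank RU c \<le> vec.dim U" and rV: "config_rank RV c \<le> vec.dim V"
    unfolding config_rank_eq_dim by (intro vec.dim_subset; auto simp: RU_def RV_def)+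
  have "config_rank R c \<le> config_rank RU c + config_rank RV c"
    using dim_UN_le[of "{RU, RV}" "\<lambda>X. c ` X"] cov disj
    by (cases "RU = RV") (auto simp: config_rank_eq_dim image_Un)
  then have "config_rank RU c \<noteq> 0" "config_rank RV c \<noteq> 0"
    using rU rV ge2 rankR by linarith+
  then have ne: "RU \<noteq> {}" "RV \<noteq> {}"
    by (auto simp: config_rank_eq_dim)
  then have neq: "RU \<noteq> RV"
    using disj by blast
  have "sum c RU + sum c RV = 0"
    using dual_homogeneous_red[OF fin nz hom] sum.union_disjoint[OF fins disj, of c] cov
    by (simp add: dual_homogeneous_def R_def c_def)
  moreover have sU: "sum c RU \<in> U" and sV: "sum c RV \<in> V"
    using sub by (auto intro!: vec.subspace_sum simp: RU_def RV_def)
  moreover have "- sum c RV \<in> V"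
    using sub sV vec.subspace_neg by blast
  ultimately have "sum c RU = 0" "sum c RV = 0"
    using UV by (auto simp: add_eq_0_iff2)
  then have "cayley_decomposition R c 1 {RU, RV}"
    using cov disj ne neq
    by (auto simp: cayley_decomposition_def partition_on_def dual_homogeneous_def disjoint_def)
  from defect_ge[OF finR this] show ?thesis
    using rU rV rankR neq unfolding R_def c_def by simp
qed

text \<open>
  Here \<open>k\<close> is the sum of \<open>rank J - 1\<close> over the parts of an optimal Cayley decomposition. The
  number of large parts is at most \<open>k\<close>, so \<open>k + 1 \<le> \<rho> \<le> 2 k\<close>; if \<open>\<rho> = 4\<close> for \<open>k = 2\<close>, there must
  be two large parts whose ranks sum to \<open>\<rho>\<close>.
\<close>

theorem reduction_of_small_codefect:
  assumes fin: "finite I" and I: "I \<noteq> {}" "dual_homogeneous I C"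
    and nz: "\<And>i. i \<in> I \<Longrightarrow> C i \<noteq> 0"
    and k: "defect I C = int (config_rank I C) - 1 - int k" "k = 1 \<or> k = 2"
  defines "\<rho> \<equiv> config_rank (red_index I C) (red_vector C)"
    and "\<theta> \<equiv> defect (red_index I C) (red_vector C)"
  shows "\<rho> = k + 1 \<and> \<theta> = 0 \<or> k = 2 \<and> \<rho> = 4 \<and> \<theta> = 1"
proof -
  obtain r P where P: "cayley_decomposition I C r P"
    and def: "defect I C = int (config_rank I C) - 1 - (\<Sum>J\<in>P. int (config_rank J C) - 1)"
    using defect_attained[OF fin I] by blast
  define Q where "Q = {J \<in> P. 2 \<le> config_rank J C}"
  have finP: "finite P"
    using fin P finite_elements by (auto simp: cayley_decomposition_def)
  have "1 \<le> config_rank J C" if "J \<in> P" for J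
    using that P nz by (intro config_rank_ge_1) (auto simp: cayley_decomposition_def partition_on_def)
  then have "(\<Sum>J\<in>P. int (config_rank J C) - 1) = (\<Sum>J\<in>Q. int (config_rank J C) - 1)"
    using finP by (intro sum.mono_neutral_right) (force simp: Q_def)+
  then have sumQ: "(\<Sum>J\<in>Q. int (config_rank J C) - 1) = int k"
    using def k by simp
  have ge1: "1 \<le> int (config_rank J C) - 1" if "J \<in> Q" for J
    using that by (simp add: Q_def)
  have cardQ: "card Q \<le> k"
    using sum_mono[of Q "\<lambda>_. 1" "\<lambda>J. int (config_rank J C) - 1"] ge1 sumQ by simp
  have "\<rho> \<le> (\<Sum>J\<in>Q. config_rank J C)"
    unfolding \<rho>_def Q_def using fin nz P by (rule rank_red_le)
  moreover have sumQ': "(\<Sum>J\<in>Q. config_rank J C) = k + card Q"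
    using sumQ by (simp add: sum_subtractf flip: of_nat_sum)
  ultimately have upper: "\<rho> \<le> k + card Q"
    by simp
  have lower: "k + 1 \<le> \<rho>"
    using defect_ge_rank_minus_rank_red[OF fin I nz] k by (auto simp: \<rho>_def)
  then have ne: "red_index I C \<noteq> {}"
    by (auto simp: \<rho>_def config_rank_eq_dim)
  have red: "finite (red_index I C)" "dual_homogeneous (red_index I C) (red_vector C)"
    using finite_red_index[OF fin] dual_homogeneous_red[OF fin nz I(2)] by auto
  have \<theta>0: "0 \<le> \<theta>"
    unfolding \<theta>_def by (rule defect_nonneg[OF red(1) ne red(2)])
  have \<theta>1: "\<theta> \<le> max 0 (int \<rho> - 3)"
    unfolding \<theta>_def \<rho>_def
    by (rule defect_le_rank_minus_3[OF red(1) ne red(2)])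
      (use red_vector_nonzero red_vectors_not_parallel in blast)+
  show ?thesis
  proof (cases "k = 2 \<and> \<rho> = 4")
    case True
    then have "card Q = 2"
      using upper cardQ by simp
    then obtain J K where JK: "Q = {J, K}" "J \<noteq> K"
      by (auto simp: card_2_iff)
    then have "\<rho> = config_rank J C + config_rank K C"
      using sumQ' True \<open>card Q = 2\<close> by simp
    then have "1 \<le> \<theta>"
      using defect_red_ge_1[OF fin nz I(2) P _ JK(2)] JK(1) by (simp add: Q_def \<theta>_def \<rho>_def)
    then show ?thesis
      using True \<theta>1 by simp
  next
    case False
    then show ?thesis
      using upper cardQ lower k(2) \<theta>0 \<theta>1 by auto
  qed
qed

section \<open>Gale duals\<close>

text \<open>
  The columns of the matrix with rows \<open>B i\<close> are independent, hence it has a left inverse and its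
  rows span the whole space.
\<close>

lemma gale_dual_rank:
  fixes A :: "'n::finite \<Rightarrow> int ^ 'k::finite" and B :: "'n \<Rightarrow> rat ^ 'm::finite"
  assumes "gale_dual A B"
  shows "int (config_rank UNIV B) = codimension A"
proof -
  define M :: "rat ^ 'm ^ 'n" where "M = (\<chi> i. B i)"
  have inj: "inj (\<lambda>j. column j M)" and ind: "vec.independent (columns M)"
    and card: "int CARD('m) = codimension A"
    using assms by (simp_all add: gale_dual_def M_def Let_def)
  have cols: "columns M = range (\<lambda>j. column j M)"
    by (auto simp: columns_def)
  have inv: "inv (\<lambda>j. column j M) (column j M) = j" for j
    using inv_f_f[OF inj] .
  have "c j = 0" if "(\<Sum>j\<in>UNIV. c j *s column j M) = 0" for c j
  proof -
    have "(\<Sum>v\<in>columns M. c (inv (\<lambda>j. column j M) v) *s v) = 0"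
      unfolding cols using that inj by (simp add: sum.reindex inv)
    then have "c (inv (\<lambda>j. column j M) (column j M)) = 0"
      using vec.independentD[OF ind, of "columns M" "\<lambda>v. c (inv (\<lambda>j. column j M) v)" "column j M"]
      by (simp add: cols)
    then show ?thesis
      by (simp add: inv)
  qed
  then have "\<exists>N. N ** M = mat 1"
    by (auto simp: matrix_left_invertible_independent_columns)
  then have "vec.span (rows M) = UNIV"
    by (simp add: matrix_left_invertible_span_rows_gen)
  moreover have "rows M = range B"
    by (auto simp: rows_def row_def M_def vec_lambda_eta)
  ultimately have "config_rank UNIV B = vec.dim (UNIV :: (rat ^ 'm) set)"
    by (simp add: config_rank_def)
  then show ?thesis
    using card by (simp add: card_cart_basis)
qed

text \<open>
  The columns of a Gale dual are orthogonal to the rows of \<open>A\<close>, hence to the all-ones vector in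
  their span.
\<close>

lemma gale_dual_dual_homogeneous:
  fixes A :: "'n::finite \<Rightarrow> int ^ 'k::finite" and B :: "'n \<Rightarrow> rat ^ 'm::finite"
  assumes "gale_dual A B" "homogeneous A"
  shows "dual_homogeneous UNIV B"
proof -
  define M :: "rat ^ 'm ^ 'n" where "M = (\<chi> i. B i)"
  have "(\<Sum>i\<in>UNIV. B i $ j) = 0" for j
  proof -
    have "column j M \<in> vec.span (columns M)"
      by (intro vec.span_base) (auto simp: columns_def)
    then have ker: "config_matrix A *v column j M = 0"
      using assms by (auto simp: gale_dual_def M_def Let_def)
    have "vec.span (rows (config_matrix A)) \<subseteq> {v. (\<Sum>i\<in>UNIV. v $ i * column j M $ i) = 0}"
    proof (rule vec.span_minimal)
      show "rows (config_matrix A) \<subseteq> {v. (\<Sum>i\<in>UNIV. v $ i * column j M $ i) = 0}"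
        using ker by (auto simp: rows_def row_def matrix_vector_mult_def vec_eq_iff)
      show "vec.subspace {v. (\<Sum>i\<in>UNIV. v $ i * column j M $ i) = 0}"
        by (auto simp: vec.subspace_def sum.distrib algebra_simps simp flip: sum_distrib_left)
    qed
    then show ?thesis
      using assms(2) by (auto simp: homogeneous_def column_def M_def)
  qed
  then show ?thesis
    by (simp add: dual_homogeneous_def vec_eq_iff)
qed

lemma separating_functional:
  fixes v :: "rat ^ 'k::finite"
  assumes "v \<notin> vec.span T"
  obtains y where "(\<Sum>k\<in>UNIV. y k * v $ k) \<noteq> 0"
    and "\<And>w. w \<in> T \<Longrightarrow> (\<Sum>k\<in>UNIV. y k * w $ k) = 0"
proof -
  obtain S where S: "S \<subseteq> vec.span T" "vec.independent S" "vec.span T \<subseteq> vec.span S"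
    using vec.basis_exists[of "vec.span T"] by metis
  have "vec.span S = vec.span T"
    using S by (metis vec.span_subspace vec.subspace_span)
  then have "vec.independent (insert v S)"
    using S assms by (simp add: vec.independent_insertI)
  \<comment> \<open>The value \<open>1\<close> at \<open>v\<close> is the all-ones vector, so every coordinate \<open>l\<close> of \<open>g\<close> will do.\<close>
  then obtain g :: "rat ^ 'k \<Rightarrow> rat ^ 'k" where g: "Vector_Spaces.linear (*s) (*s) g"
    and "\<forall>x\<in>insert v S. g x = (if x = v then 1 else 0)"
    using vec.linear_independent_extend[of "insert v S" "\<lambda>x. if x = v then 1 else 0"]
    by blast
  then have gi: "g x = (if x = v then 1 else 0)" if "x \<in> insert v S" for x
    using that by blast
  interpret g: Vector_Spaces.linear "(*s)" "(*s)" g by fact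
  obtain l :: 'k where True by simp
  define y where "y k = g (axis k 1) $ l" for k
  have gy: "g x $ l = (\<Sum>k\<in>UNIV. y k * x $ k)" for x
  proof -
    have "g x = (\<Sum>k\<in>UNIV. x $ k *s g (axis k 1))"
      by (subst basis_expansion[of x, symmetric]) (simp only: g.sum g.scale)
    then show ?thesis
      by (simp add: y_def mult.commute)
  qed
  have g0: "g x = 0" if "x \<in> vec.span S" for x
  proof (rule g.eq_0_on_span[OF _ that])
    fix b assume "b \<in> S"
    then show "g b = 0"
      using gi[of b] assms S(1) by auto
  qed
  have "g w = 0" if "w \<in> T" for w
    using S(3) vec.span_base[OF that] by (intro g0) (rule subsetD)
  then have "(\<Sum>k\<in>UNIV. y k * w $ k) = 0" if "w \<in> T" for w
    using that gy[of w] by simp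
  moreover have "(\<Sum>k\<in>UNIV. y k * v $ k) \<noteq> 0"
    using gy[of v] gi[of v] by simp
  ultimately show thesis
    using that by blast
qed

text \<open>
  If \<open>B i\<close> vanishes, then no linear relation among the columns of \<open>A\<close> involves the column \<open>i\<close>. That
  column is therefore outside the rational span of the others, and a rational functional
  separating it from them, read over the reals, exhibits a hyperplane that makes \<open>A\<close> a pyramid.
  Passing through a functional avoids turning a real relation into a rational one.
\<close>

lemma gale_dual_nonzero:
  fixes A :: "'n::finite \<Rightarrow> int ^ 'k::finite" and B :: "'n \<Rightarrow> rat ^ 'm::finite"
  assumes "gale_dual A B" "\<not> pyramid A"
  shows "B i \<noteq> 0"
proof
  assume "B i = 0"
  define M :: "rat ^ 'm ^ 'n" where "M = (\<chi> i. B i)"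
  define a where "a j = column j (config_matrix A)" for j
  have a: "a j $ k = of_int (A j $ k)" for j k
    by (simp add: a_def column_def config_matrix_def)
  have ker: "x $ i = 0" if "config_matrix A *v x = 0" for x
  proof -
    have "x \<in> vec.span (columns M)"
      using that assms by (simp add: gale_dual_def M_def Let_def)
    also have "\<dots> \<subseteq> {x. x $ i = 0}"
      using \<open>B i = 0\<close>
      by (intro vec.span_minimal) (auto simp: columns_def column_def M_def vec.subspace_def)
    finally show ?thesis by simp
  qed
  \<comment> \<open>Otherwise there is a relation with coefficient \<open>-1\<close> at \<open>i\<close>.\<close>
  have notin: "a i \<notin> vec.span (a ` (UNIV - {i}))"
  proof
    assume "a i \<in> vec.span (a ` (UNIV - {i}))"
    then have "\<exists>u. a i = (\<Sum>j\<in>UNIV - {i}. u j *s a j)"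
    proof (induction rule: vec.span_induct)
      show "vec.subspace {v. \<exists>u. v = (\<Sum>j\<in>UNIV - {i}. u j *s a j)}"
        unfolding vec.subspace_def
      proof (safe, goal_cases)
        case 1 show ?case by (rule exI[of _ "\<lambda>_. 0"]) simp
      next
        case (2 _ _ u w)
        show ?case
          by (rule exI[of _ "\<lambda>j. u j + w j"]) (simp add: vec.scale_left_distrib sum.distrib)
      next
        case (3 c _ u)
        show ?case
          by (rule exI[of _ "\<lambda>j. c * u j"]) (simp add: vec.scale_sum_right)
      qed
    next
      fix v assume "v \<in> a ` (UNIV - {i})"
      then obtain j where j: "j \<in> UNIV - {i}" "v = a j" by blast
      show "\<exists>u. v = (\<Sum>j\<in>UNIV - {i}. u j *s a j)"
        by (rule exI[of _ "\<lambda>l. if l = j then 1 else 0"])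
          (use j in \<open>simp add: if_distrib[of "\<lambda>c. c *s _"] cong: if_cong\<close>)
    qed
    then obtain u where u: "a i = (\<Sum>j\<in>UNIV - {i}. u j *s a j)" by blast
    define x where "x = (\<chi> j. if j = i then - 1 else u j)"
    have "config_matrix A *v x = (\<Sum>j\<in>UNIV. x $ j *s a j)"
      by (simp add: matrix_mult_sum a_def)
    also have "\<dots> = x $ i *s a i + (\<Sum>j\<in>UNIV - {i}. x $ j *s a j)"
      by (rule sum.remove) auto
    also have "(\<Sum>j\<in>UNIV - {i}. x $ j *s a j) = (\<Sum>j\<in>UNIV - {i}. u j *s a j)"
      by (rule sum.cong) (auto simp: x_def)
    finally have "config_matrix A *v x = 0"
      using u by (simp add: x_def)
    from ker[OF this] show False
      by (simp add: x_def)
  qed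
  obtain y where y: "(\<Sum>k\<in>UNIV. y k * a i $ k) \<noteq> 0"
    and yT: "\<And>w. w \<in> a ` (UNIV - {i}) \<Longrightarrow> (\<Sum>k\<in>UNIV. y k * w $ k) = 0"
    by (rule separating_functional[OF notin]) blast
  have y0: "(\<Sum>k\<in>UNIV. y k * a j $ k) = 0" if "j \<noteq> i" for j
    using that by (intro yT) simp
  define H :: "(real ^ 'k) set" where "H = {x. (\<Sum>k\<in>UNIV. of_rat (y k) * x $ k) = 0}"
  have eval: "(\<Sum>k\<in>UNIV. of_rat (y k) * real_point (A j) $ k)
                = (of_rat (\<Sum>k\<in>UNIV. y k * a j $ k) :: real)" for j
    by (simp add: real_point_def a of_rat_sum of_rat_mult)
  have "affine hull ((\<lambda>j. real_point (A j)) ` (UNIV - {i})) \<subseteq> H"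
  proof (rule hull_minimal)
    show "(\<lambda>j. real_point (A j)) ` (UNIV - {i}) \<subseteq> H"
      using y0 by (auto simp: H_def eval)
    have "subspace H"
      by (auto simp: subspace_def H_def sum.distrib algebra_simps simp flip: sum_distrib_left)
    then show "affine H"
      by (rule subspace_imp_affine)
  qed
  moreover have "real_point (A i) \<notin> H"
    using y by (simp add: H_def eval)
  ultimately show False
    using assms(2) by (auto simp: pyramid_def)
qed

theorem proposition4p22:
  fixes A A' :: "'n::finite \<Rightarrow> int ^ 'k::finite"
    and k0 :: 'k
    and d :: nat
    and B :: "'n \<Rightarrow> rat ^ 'm::finite"
  assumes "CARD('k) = d + 1"
    and "\<And>i. A' i \<in> coord_lattice k0"
    and "group_closure {A' i - A' j | i j. True} = coord_lattice k0"
    and "\<And>i. A i = cone_point k0 (A' i)"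
    and "affine_dimension A = int d"
    and "homogeneous A"
    and "\<not> pyramid A"
    and "gale_dual A B"
  shows "(defect UNIV B = codimension A - 2 \<longrightarrow>
            non_defective (red_index UNIV B) (red_vector B) \<and>
            config_rank (red_index UNIV B) (red_vector B) = 2) \<and>
         (defect UNIV B = codimension A - 3 \<longrightarrow>
            (non_defective (red_index UNIV B) (red_vector B) \<and>
             config_rank (red_index UNIV B) (red_vector B) = 3) \<or>
            (config_rank (red_index UNIV B) (red_vector B) = 4 \<and>
             defect (red_index UNIV B) (red_vector B) = 1))"
proof -
  have rank: "int (config_rank UNIV B) = codimension A"
    using assms(8) by (rule gale_dual_rank)
  have hom: "dual_homogeneous UNIV B"
    using assms(8,6) by (rule gale_dual_dual_homogeneous)
  have nz: "B i \<noteq> 0" for i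
    using assms(8,7) by (rule gale_dual_nonzero)
  note red = reduction_of_small_codefect[OF finite UNIV_not_empty hom nz]
  show ?thesis
    using red[of 1] red[of 2] rank by (auto simp: non_defective_def)
qed

end
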